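(* Let $P$ be a polygon in the plane with nonzero signed area that is inscribed in a circle (all its vertices lie on the circle). Then the Circumcenter of Mass $CCM(P)$ is the center of that circle.
   Context: A polygon $P=(V_1,\dots,V_n)$, $n\ge 3$, is a closed oriented polygon in $\mathbb{R}^2$ given by the cyclic sequence of its vertices (indices mod $n$), consecutive vertices being distinct; self-intersections are allowed. With $V_i=(x_i,y_i)$ its signed area is $A(P)=\tfrac12\sum_i (x_iy_{i+1}-x_{i+1}y_i)$. If $A(P)\ne0$, the Circumcenter of Mass is $CCM(P)=\sum_i \frac{A_i}{A(P)}C_i$, where $O$ is any point not on the sides of $P$ or their extensions, $C_i$ is the circumcenter of the triangle $OV_iV_{i+1}$, and $A_i=\tfrac12\det(V_i-O,V_{i+1}-O)$ is its signed area; this does not depend on the choice of $O$. *)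

theory Defs
  imports "HOL-Analysis.Analysis"
begin

text \<open>A polygon is the list of its vertices in cyclic order; the successor of the vertex with
  index \<open>i\<close> has index \<open>Suc i mod length P\<close>. Self-intersections are allowed.\<close>

definition polygon :: "(real ^ 2) list \<Rightarrow> bool" where
  "polygon P \<longleftrightarrow>
     length P \<ge> 3 \<and> (\<forall>i < length P. P ! i \<noteq> P ! (Suc i mod length P))"

definition signed_area :: "(real ^ 2) list \<Rightarrow> real" where
  "signed_area P =
     (1/2) * (\<Sum>i < length P. (P ! i) $ 1 * (P ! (Suc i mod length P)) $ 2
                             - (P ! (Suc i mod length P)) $ 1 * (P ! i) $ 2)"

definition triangle_area :: "real ^ 2 \<Rightarrow> real ^ 2 \<Rightarrow> real ^ 2 \<Rightarrow> real" where
  "triangle_area A B C = (1/2) * det (vector [B - A, C - A] :: real ^ 2 ^ 2)"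

text \<open>Meaningful for non-collinear points only.\<close>

definition circumcenter :: "real ^ 2 \<Rightarrow> real ^ 2 \<Rightarrow> real ^ 2 \<Rightarrow> real ^ 2" where
  "circumcenter A B C = (THE X. dist X A = dist X B \<and> dist X B = dist X C)"

definition off_side_lines :: "(real ^ 2) list \<Rightarrow> real ^ 2 \<Rightarrow> bool" where
  "off_side_lines P Q \<longleftrightarrow>
     (\<forall>i < length P. Q \<notin> affine hull {P ! i, P ! (Suc i mod length P)})"

definition CCM_from :: "real ^ 2 \<Rightarrow> (real ^ 2) list \<Rightarrow> real ^ 2" where
  "CCM_from Q P =
     (\<Sum>i < length P. (triangle_area Q (P ! i) (P ! (Suc i mod length P)) / signed_area P)
        *\<^sub>R circumcenter Q (P ! i) (P ! (Suc i mod length P)))"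

text \<open>The common value of \<open>CCM_from Q P\<close> over all base points \<open>Q\<close> off the side lines; existence and
  uniqueness of this value are shown in \<open>CCM_eq_CCM_from\<close> and
  \<open>off_side_lines_exists\<close> below. As division by zero yields zero, it has its intended meaning only
  for nonzero signed area.\<close>

definition CCM :: "(real ^ 2) list \<Rightarrow> real ^ 2" where
  "CCM P = (THE X. \<exists>Q. off_side_lines P Q \<and> X = CCM_from Q P)"

lemma off_side_lines_exists: "\<exists>Q. off_side_lines P Q"
proof -
  let ?L = "\<lambda>i. affine hull {P ! i, P ! (Suc i mod length P)}"
  have "negligible (?L i)" for i
  proof -
    have "interior (?L i) = {}"
    proof (rule ccontr)
      assume "interior (?L i) \<noteq> {}"
      then have "aff_dim (?L i) = 2"
        by (simp add: aff_dim_nonempty_interior del: aff_dim_affine_hull)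
      then show False
        by (simp split: if_splits)
    qed
    then show ?thesis
      by (simp add: negligible_convex_interior affine_imp_convex)
  qed
  then have "negligible (\<Union>i \<in> {..<length P}. ?L i)"
    by (intro negligible_Union) auto
  then have "(\<Union>i \<in> {..<length P}. ?L i) \<noteq> UNIV"
    by (metis non_negligible_UNIV)
  then show ?thesis
    by (auto simp: off_side_lines_def)
qed

lemma triangle_area_expand:
  "triangle_area A B C = ((B$1 - A$1) * (C$2 - A$2) - (B$2 - A$2) * (C$1 - A$1)) / 2"
  by (simp add: triangle_area_def det_2)

lemma triangle_area_nonzero:
  assumes "B \<noteq> C" "A \<notin> affine hull {B, C}"
  shows "triangle_area A B C \<noteq> 0"
proof
  assume "triangle_area A B C = 0"
  then have z: "(B$1 - A$1) * (C$2 - A$2) = (B$2 - A$2) * (C$1 - A$1)"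
    by (simp add: triangle_area_expand)
  have "\<exists>u. A = B + u *\<^sub>R (C - B)"
  proof (cases "C$1 = B$1")
    case True
    with assms(1) have "C$2 \<noteq> B$2" by (auto simp: vec_eq_iff forall_2)
    moreover from z True have "(B$1 - A$1) * (C$2 - B$2) = 0"
      by (simp add: algebra_simps)
    ultimately have "B$1 = A$1" by simp
    moreover have "A$2 = B$2 + (A$2 - B$2) / (C$2 - B$2) * (C$2 - B$2)"
      using \<open>C$2 \<noteq> B$2\<close> by simp
    ultimately show ?thesis
      using True by (intro exI[of _ "(A$2 - B$2) / (C$2 - B$2)"]) (simp add: vec_eq_iff forall_2)
  next
    case False
    then have "A$1 = B$1 + (A$1 - B$1) / (C$1 - B$1) * (C$1 - B$1)" by simp
    moreover have "(A$1 - B$1) * (C$2 - B$2) = (A$2 - B$2) * (C$1 - B$1)"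
      using z by (simp add: algebra_simps)
    then have "A$2 = B$2 + (A$1 - B$1) / (C$1 - B$1) * (C$2 - B$2)"
      using False by (simp add: divide_simps)
    ultimately show ?thesis
      by (intro exI[of _ "(A$1 - B$1) / (C$1 - B$1)"]) (simp add: vec_eq_iff forall_2)
  qed
  then obtain u where "A = (1 - u) *\<^sub>R B + u *\<^sub>R C"
    by (auto simp: algebra_simps)
  then have "A \<in> affine hull {B, C}"
    unfolding affine_hull_2 by (intro CollectI exI[of _ "1 - u"] exI[of _ u]) simp
  with assms(2) show False by simp
qed

lemma dist_eq_iff_2:
  fixes X A B :: "real ^ 2"
  shows "dist X A = dist X B \<longleftrightarrow>
    2 * (B$1 - A$1) * (X$1 - A$1) + 2 * (B$2 - A$2) * (X$2 - A$2)
      = (B$1 - A$1)\<^sup>2 + (B$2 - A$2)\<^sup>2"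
proof -
  have "dist X A = dist X B \<longleftrightarrow> (X$1-A$1)\<^sup>2 + (X$2-A$2)\<^sup>2 = (X$1-B$1)\<^sup>2 + (X$2-B$2)\<^sup>2"
    by (simp add: dist_vec_def L2_set_def sum_2 dist_real_def)
  then show ?thesis
    by (simp add: power2_eq_square algebra_simps) 
qed

lemma triangle_area_circumcenter:
  assumes d: "triangle_area A B C \<noteq> 0"
  defines "b1 \<equiv> B$1 - A$1" and "b2 \<equiv> B$2 - A$2" and "c1 \<equiv> C$1 - A$1" and "c2 \<equiv> C$2 - A$2"
  shows "triangle_area A B C *\<^sub>R circumcenter A B C =
    vector [triangle_area A B C * A$1 + ((b1\<^sup>2 + b2\<^sup>2) * c2 - (c1\<^sup>2 + c2\<^sup>2) * b2) / 4,
            triangle_area A B C * A$2 + ((c1\<^sup>2 + c2\<^sup>2) * b1 - (b1\<^sup>2 + b2\<^sup>2) * c1) / 4]"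
proof -
  define D where "D = b1 * c2 - b2 * c1"
  have TD: "triangle_area A B C = D / 2"
    by (simp add: D_def triangle_area_expand b1_def b2_def c1_def c2_def)
  with d have D0: "D \<noteq> 0" by simp
  define X :: "real ^ 2" where
    "X = vector [A$1 + ((b1\<^sup>2 + b2\<^sup>2) * c2 - (c1\<^sup>2 + c2\<^sup>2) * b2) / (2 * D),
                 A$2 + ((c1\<^sup>2 + c2\<^sup>2) * b1 - (b1\<^sup>2 + b2\<^sup>2) * c1) / (2 * D)]"
  have eqs: "dist Y A = dist Y B \<and> dist Y B = dist Y C \<longleftrightarrow>
      2 * b1 * (Y$1 - A$1) + 2 * b2 * (Y$2 - A$2) = b1\<^sup>2 + b2\<^sup>2 \<and>
      2 * c1 * (Y$1 - A$1) + 2 * c2 * (Y$2 - A$2) = c1\<^sup>2 + c2\<^sup>2" for Y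
    using dist_eq_iff_2[of Y A B] dist_eq_iff_2[of Y A C]
    by (auto simp: b1_def b2_def c1_def c2_def)
  have "circumcenter A B C = X"
    unfolding circumcenter_def
  proof (rule the_equality)
    have "2 * b1 * (X$1 - A$1) + 2 * b2 * (X$2 - A$2) = ((b1\<^sup>2 + b2\<^sup>2) * D) / D"
      unfolding X_def by (simp add: D_def divide_simps) (simp add: algebra_simps)
    moreover have "2 * c1 * (X$1 - A$1) + 2 * c2 * (X$2 - A$2) = ((c1\<^sup>2 + c2\<^sup>2) * D) / D"
      unfolding X_def by (simp add: D_def divide_simps) (simp add: algebra_simps)
    ultimately show "dist X A = dist X B \<and> dist X B = dist X C"
      unfolding eqs using D0 by simp
  next
    fix Y assume "dist Y A = dist Y B \<and> dist Y B = dist Y C"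
    then have e: "2 * b1 * (Y$1 - A$1) + 2 * b2 * (Y$2 - A$2) = b1\<^sup>2 + b2\<^sup>2"
      "2 * c1 * (Y$1 - A$1) + 2 * c2 * (Y$2 - A$2) = c1\<^sup>2 + c2\<^sup>2"
      unfolding eqs by auto
    have "2 * D * (Y$1 - A$1) = (b1\<^sup>2 + b2\<^sup>2) * c2 - (c1\<^sup>2 + c2\<^sup>2) * b2"
      unfolding e[symmetric] D_def by (simp add: algebra_simps)
    moreover have "2 * D * (Y$2 - A$2) = (c1\<^sup>2 + c2\<^sup>2) * b1 - (b1\<^sup>2 + b2\<^sup>2) * c1"
      unfolding e[symmetric] D_def by (simp add: algebra_simps)
    ultimately show "Y = X"
      using D0 by (simp add: X_def vec_eq_iff forall_2 field_simps)
  qed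
  then show ?thesis
    using D0 by (simp add: TD X_def vec_eq_iff forall_2 field_simps)
qed

lemma sum_cyclic_shift:
  fixes h :: "'a \<Rightarrow> 'b::comm_monoid_add"
  shows "(\<Sum>i < length P. h (P ! (Suc i mod length P))) = (\<Sum>i < length P. h (P ! i))"
proof -
  have "(\<Sum>i < length P. h (P ! (Suc i mod length P))) = (\<Sum>i < length P. h (rotate1 P ! i))"
    by (intro sum.cong) (auto simp: nth_rotate1)
  also have "\<dots> = sum_list (map h (rotate1 P))"
    by (simp add: sum_list_sum_nth atLeast0LessThan)
  also have "\<dots> = sum_list (map h P)"
    by (cases P) (simp_all add: add.commute)
  also have "\<dots> = (\<Sum>i < length P. h (P ! i))"
    by (simp add: sum_list_sum_nth atLeast0LessThan)
  finally show ?thesis .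
qed

lemma CCM_from_explicit:
  assumes "polygon P" "off_side_lines P Q"
  shows "CCM_from Q P = (1 / (4 * signed_area P)) *\<^sub>R
    (\<Sum>i < length P. let V = P ! i; W = P ! (Suc i mod length P) in
       vector [(norm V)\<^sup>2 * W$2 - (norm W)\<^sup>2 * V$2, (norm W)\<^sup>2 * V$1 - (norm V)\<^sup>2 * W$1])"
proof -
  define W where "W = (\<lambda>i. P ! (Suc i mod length P))"
  define F :: "real^2 \<Rightarrow> real^2 \<Rightarrow> real^2" where "F = (\<lambda>V W. vector
    [(norm V)\<^sup>2 * W$2 - (norm W)\<^sup>2 * V$2, (norm W)\<^sup>2 * V$1 - (norm V)\<^sup>2 * W$1])"
  define s where "s = (\<lambda>V :: real^2. Q$1 * V$1 + Q$2 * V$2)"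
  define t where "t = (\<lambda>V :: real^2. Q$2 * V$1 - Q$1 * V$2)"
  define q where "q = (Q$1)\<^sup>2 + (Q$2)\<^sup>2"
  define h :: "real^2 \<Rightarrow> real^2" where "h = (\<lambda>V. vector
    [2 * Q$1 * t V + Q$2 * (norm V)\<^sup>2 - 2 * Q$2 * s V + q * V$2,
     2 * Q$2 * t V - Q$1 * (norm V)\<^sup>2 + 2 * Q$1 * s V - q * V$1])"
  have nrm: "(norm V)\<^sup>2 = (V$1)\<^sup>2 + (V$2)\<^sup>2" for V :: "real^2"
    by (simp add: norm_vec_def L2_set_def sum_2)
  have key: "4 *\<^sub>R (triangle_area Q V U *\<^sub>R circumcenter Q V U) = F V U + (h U - h V)"
    if "triangle_area Q V U \<noteq> 0" for V U
    unfolding triangle_area_circumcenter[OF that] F_def h_def nrm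
    by (simp add: vec_eq_iff forall_2 s_def t_def q_def triangle_area_expand
        field_simps power2_eq_square)
  have "4 *\<^sub>R (triangle_area Q (P!i) (W i) *\<^sub>R circumcenter Q (P!i) (W i))
      = F (P!i) (W i) + (h (W i) - h (P!i))" if "i < length P" for i
    using assms that
    by (intro key triangle_area_nonzero) (auto simp: polygon_def off_side_lines_def W_def)
  then have "(\<Sum>i < length P. 4 *\<^sub>R (triangle_area Q (P!i) (W i) *\<^sub>R circumcenter Q (P!i) (W i)))
      = (\<Sum>i < length P. F (P!i) (W i) + (h (W i) - h (P!i)))"
    by (intro sum.cong) auto
  also have "\<dots> = (\<Sum>i < length P. F (P!i) (W i))"
    using sum_cyclic_shift[of h P] by (simp add: sum.distrib sum_subtractf W_def)
  finally have *: "4 *\<^sub>R (\<Sum>i < length P. triangle_area Q (P!i) (W i) *\<^sub>R circumcenter Q (P!i) (W i))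
      = (\<Sum>i < length P. F (P!i) (W i))"
    by (simp only: scaleR_sum_right)
  have "CCM_from Q P = (1 / signed_area P) *\<^sub>R
      (\<Sum>i < length P. triangle_area Q (P!i) (W i) *\<^sub>R circumcenter Q (P!i) (W i))"
    by (simp add: CCM_from_def W_def scaleR_sum_right)
  also have "\<dots> = (1 / (4 * signed_area P)) *\<^sub>R (\<Sum>i < length P. F (P!i) (W i))"
    unfolding *[symmetric] by simp
  finally show ?thesis
    by (simp add: F_def W_def Let_def)
qed

lemma CCM_eq_CCM_from:
  assumes "polygon P" "off_side_lines P Q"
  shows "CCM P = CCM_from Q P"
  unfolding CCM_def
  using assms CCM_from_explicit[OF assms(1)] by (intro the_equality) auto

end

(* On the circle |V|^2 is an affine function k + 2 (c . V) of V. In the explicit formula for CCM the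
   constant k contributes only differences of consecutive terms, which cancel around the polygon,
   and the linear part contributes 2 det(V, W) c for each side VW, so 4 A(P) c in total. *)
theory Submission
  imports Defs
begin

text \<open>Expand |V - c|^2 = r^2 by bilinearity of the inner product. This lets every squared norm
  in the explicit formula be replaced by an affine function of the vertex.\<close>

lemma norm_pow2_on_sphere:
  fixes V :: "'a::real_inner"
  assumes "V \<in> sphere c r"
  shows "(norm V)\<^sup>2 = r\<^sup>2 - (norm c)\<^sup>2 + 2 * (c \<bullet> V)"
proof -
  have "(norm (V - c))\<^sup>2 = r\<^sup>2"
    using assms by (simp add: dist_norm norm_minus_commute)
  then show ?thesis
    by (simp add: power2_norm_eq_inner inner_diff inner_commute)
qed

theorem corollary3p2:
  fixes P :: "(real ^ 2) list" and c :: "real ^ 2" and r :: real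
  assumes "polygon P"
    and "signed_area P \<noteq> 0"
    and "r > 0"
    and "set P \<subseteq> sphere c r"
  shows "CCM P = c"
proof -
  define W where "W = (\<lambda>i. P ! (Suc i mod length P))"
  define F :: "real^2 \<Rightarrow> real^2 \<Rightarrow> real^2" where "F = (\<lambda>V U. vector
    [(norm V)\<^sup>2 * U$2 - (norm U)\<^sup>2 * V$2, (norm U)\<^sup>2 * V$1 - (norm V)\<^sup>2 * U$1])"
  \<comment> \<open>The factor is the constant term of that affine function; the vector is V turned
    clockwise by a right angle, written JV below.\<close>
  define h :: "real^2 \<Rightarrow> real^2" where
    "h = (\<lambda>V. (r\<^sup>2 - (norm c)\<^sup>2) *\<^sub>R vector [V$2, - V$1])"
  define cr :: "real^2 \<Rightarrow> real^2 \<Rightarrow> real" where "cr = (\<lambda>V U. V$1 * U$2 - U$1 * V$2)"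
  \<comment> \<open>The linear parts combine through the planar identity (c . V) JU - (c . U) JV =
    det(V, U) c.\<close>
  have key: "F V U = (h U - h V) + (2 * cr V U) *\<^sub>R c"
    if "V \<in> sphere c r" "U \<in> sphere c r" for V U
    unfolding F_def h_def cr_def norm_pow2_on_sphere[OF that(1)] norm_pow2_on_sphere[OF that(2)]
    by (simp add: vec_eq_iff forall_2 inner_vec_def sum_2 algebra_simps)
  have "F (P ! i) (W i) = (h (W i) - h (P ! i)) + (2 * cr (P ! i) (W i)) *\<^sub>R c"
    if "i < length P" for i
  proof (rule key)
    from that have "Suc i mod length P < length P"
      by (intro mod_less_divisor) auto
    with that assms(4) show "P ! i \<in> sphere c r" "W i \<in> sphere c r"
      unfolding W_def by (meson nth_mem subsetD)+
  qed
  then have "(\<Sum>i < length P. F (P ! i) (W i))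
      = (\<Sum>i < length P. (h (W i) - h (P ! i)) + (2 * cr (P ! i) (W i)) *\<^sub>R c)"
    by (intro sum.cong) auto
  \<comment> \<open>The \<open>h\<close> terms cancel because the successors \<open>W i\<close> run
    through the same vertices as \<open>P ! i\<close>, shifted cyclically.\<close>
  also have "\<dots> = (2 * (\<Sum>i < length P. cr (P ! i) (W i))) *\<^sub>R c"
    using sum_cyclic_shift[of h P]
    by (simp add: sum.distrib sum_subtractf W_def scaleR_sum_left sum_distrib_left)
  also have "\<dots> = (4 * signed_area P) *\<^sub>R c"
    by (simp add: signed_area_def cr_def W_def)
  finally have sum_F: "(\<Sum>i < length P. F (P ! i) (W i)) = (4 * signed_area P) *\<^sub>R c" .
  \<comment> \<open>A base point gives access to the explicit formula, whose right-hand side no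
    longer mentions \<open>Q\<close>.\<close>
  obtain Q where Q: "off_side_lines P Q"
    using off_side_lines_exists by blast
  have "CCM P = (1 / (4 * signed_area P)) *\<^sub>R (\<Sum>i < length P. F (P ! i) (W i))"
    using CCM_eq_CCM_from[OF assms(1) Q] CCM_from_explicit[OF assms(1) Q]
    by (simp add: F_def W_def Let_def)
  with sum_F assms(2) show ?thesis
    by simp
qed

end
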